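(* Let $K\geqslant 1$, let $\mathbb{T}$ be a non-empty linearly ordered set and let $\{(X_t,d_t): t\in\mathbb{T}\}$ be a family of strong $b$-metric spaces (respectively, $b$-metric spaces), all with the same relaxation constant $K$, which is increasing, i.e. for all $s\leqslant t$ in $\mathbb{T}$ we have $X_s\subseteq X_t$ and $d_s(x,y)=d_t(x,y)$ for all $x,y\in X_s$. Define $$X:=\bigcup_{t\in\mathbb{T}}X_t,\qquad d(x,y):=d_p(x,y),\ \text{ where } p\in\mathbb{T} \text{ is any index such that } x,y\in X_p.$$ Then $(X,d)$ is a strong $b$-metric space (respectively, a $b$-metric space) with relaxation constant $K$.
   Context: A semimetric space is a non-empty set $X$ with a function $d:X\times X\to[0,+\infty)$ (a semimetric) such that for all $x,y\in X$: $d(x,y)=0$ iff $x=y$, and $d(x,y)=d(y,x)$. For $K\geqslant 1$, a semimetric space $(X,d)$ is a strong $b$-metric space with relaxation constant $K$ if $d(x,z)\leqslant K d(x,y)+d(y,z)$ for all $x,y,z\in X$, and a $b$-metric space with relaxation constant $K$ if $d(x,z)\leqslant K(d(x,y)+d(y,z))$ for all $x,y,z\in X$. The statement consists of two versions: one for strong $b$-metric spaces throughout and one for $b$-metric spaces throughout. *)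

theory Defs
  imports Complex_Main
begin

text \<open>
  A space is a carrier set together with a distance function on the ambient type; only the
  values of the distance function on the carrier matter.
\<close>

definition semimetric_space :: "'a set \<Rightarrow> ('a \<Rightarrow> 'a \<Rightarrow> real) \<Rightarrow> bool" where
  "semimetric_space X d \<longleftrightarrow>
     X \<noteq> {} \<and>
     (\<forall>x\<in>X. \<forall>y\<in>X. 0 \<le> d x y) \<and>
     (\<forall>x\<in>X. \<forall>y\<in>X. d x y = 0 \<longleftrightarrow> x = y) \<and>
     (\<forall>x\<in>X. \<forall>y\<in>X. d x y = d y x)"

definition strong_b_metric_space :: "real \<Rightarrow> 'a set \<Rightarrow> ('a \<Rightarrow> 'a \<Rightarrow> real) \<Rightarrow> bool" where
  "strong_b_metric_space K X d \<longleftrightarrow>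
     K \<ge> 1 \<and> semimetric_space X d \<and>
     (\<forall>x\<in>X. \<forall>y\<in>X. \<forall>z\<in>X. d x z \<le> K * d x y + d y z)"

definition b_metric_space :: "real \<Rightarrow> 'a set \<Rightarrow> ('a \<Rightarrow> 'a \<Rightarrow> real) \<Rightarrow> bool" where
  "b_metric_space K X d \<longleftrightarrow>
     K \<ge> 1 \<and> semimetric_space X d \<and>
     (\<forall>x\<in>X. \<forall>y\<in>X. \<forall>z\<in>X. d x z \<le> K * (d x y + d y z))"

definition increasing_family ::
    "'i set \<Rightarrow> 'i rel \<Rightarrow> ('i \<Rightarrow> 'a set) \<Rightarrow> ('i \<Rightarrow> 'a \<Rightarrow> 'a \<Rightarrow> real) \<Rightarrow> bool" where
  "increasing_family T r X d \<longleftrightarrow>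
     (\<forall>s\<in>T. \<forall>t\<in>T. (s, t) \<in> r \<longrightarrow>
        X s \<subseteq> X t \<and> (\<forall>x\<in>X s. \<forall>y\<in>X s. d s x y = d t x y))"

text \<open>
  The index is selected by Hilbert choice. On its own this does not say that the value is
  independent of the index, nor that a suitable index exists; both have to be shown for
  increasing families.
\<close>

definition union_dist ::
    "'i set \<Rightarrow> ('i \<Rightarrow> 'a set) \<Rightarrow> ('i \<Rightarrow> 'a \<Rightarrow> 'a \<Rightarrow> real) \<Rightarrow> 'a \<Rightarrow> 'a \<Rightarrow> real" where
  "union_dist T X d x y = d (SOME p. p \<in> T \<and> x \<in> X p \<and> y \<in> X p) x y"

end

theory Submission
  imports Defs
begin

text \<open>
  The union is non-empty because there is an index and every member is non-empty. All other axioms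
  of a strong b-metric or b-metric space speak of at most three points at a time. Since the indices
  are linearly ordered and the carriers increase, any three points of the union already lie in a
  single member of the family (\<open>increasing_family_common_index3\<close>), and on every member the
  distance on the union is the distance of that member (\<open>union_dist_eq\<close>). Hence each of these
  axioms for the union is an instance of the same axiom in one member, with the same constant.
\<close>

lemma increasing_family_common_index:
  assumes "linear_order_on T r" "increasing_family T r X d"
    and "s \<in> T" "t \<in> T"
  obtains p where "p \<in> T" "X s \<subseteq> X p" "X t \<subseteq> X p"
proof (cases "s = t")
  case True
  then show thesis using assms(3) that by blast
next
  case False
  then have "(s, t) \<in> r \<or> (t, s) \<in> r"
    using assms(1,3,4) by (auto simp: linear_order_on_def total_on_def)
  then show thesis
    using assms(2-4) that unfolding increasing_family_def by blast
qed

lemma increasing_family_common_index3: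
  assumes "linear_order_on T r" "increasing_family T r X d"
    and "x \<in> (\<Union>t\<in>T. X t)" "y \<in> (\<Union>t\<in>T. X t)" "z \<in> (\<Union>t\<in>T. X t)"
  obtains p where "p \<in> T" "x \<in> X p" "y \<in> X p" "z \<in> X p"
proof -
  obtain a b c where idx: "a \<in> T" "x \<in> X a" "b \<in> T" "y \<in> X b" "c \<in> T" "z \<in> X c"
    using assms(3-5) by blast
  obtain q where q: "q \<in> T" "X a \<subseteq> X q" "X b \<subseteq> X q"
    by (rule increasing_family_common_index[OF assms(1,2) idx(1,3)])
  obtain p where p: "p \<in> T" "X q \<subseteq> X p" "X c \<subseteq> X p"
    by (rule increasing_family_common_index[OF assms(1,2) q(1) idx(5)])
  show thesis
  proof (rule that[OF p(1)])
    show "x \<in> X p" "y \<in> X p" "z \<in> X p" using p(2,3) q(2,3) idx(2,4,6) by blast+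
  qed
qed

text \<open>
  The index chosen in \<open>union_dist\<close> is comparable with \<open>p\<close>, so the two distances agree on the
  smaller of the two carriers, which contains both points.
\<close>

lemma union_dist_eq:
  assumes "linear_order_on T r" "increasing_family T r X d"
    and "p \<in> T" "x \<in> X p" "y \<in> X p"
  shows "union_dist T X d x y = d p x y"
proof -
  define q where "q = (SOME q. q \<in> T \<and> x \<in> X q \<and> y \<in> X q)"
  have q: "q \<in> T \<and> x \<in> X q \<and> y \<in> X q"
    unfolding q_def using assms(3-5) by (rule someI[where x = p, OF conjI[OF _ conjI]])
  have agree: "d s x y = d t x y"
    if "s \<in> T" "t \<in> T" "(s, t) \<in> r" "x \<in> X s" "y \<in> X s" for s t
    using assms(2) that unfolding increasing_family_def by blast
  consider "p = q" | "(p, q) \<in> r" | "(q, p) \<in> r"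
    using assms(1,3) q unfolding linear_order_on_def total_on_def by blast
  then have "d q x y = d p x y"
  proof cases
    case 1
    then show ?thesis by simp
  next
    case 2
    show ?thesis by (rule agree[OF assms(3) _ 2 assms(4,5), symmetric]) (use q in blast)
  next
    case 3
    show ?thesis by (rule agree[OF _ assms(3) 3]) (use q in blast)+
  qed
  then show ?thesis by (simp add: union_dist_def q_def)
qed

lemma semimetric_space_UNION:
  assumes "T \<noteq> {}" "linear_order_on T r" "increasing_family T r X d"
    and semi: "\<And>t. t \<in> T \<Longrightarrow> semimetric_space (X t) (d t)"
  shows "semimetric_space (\<Union>t\<in>T. X t) (union_dist T X d)"
proof -
  have "(\<Union>t\<in>T. X t) \<noteq> {}"
  proof -
    obtain t where t: "t \<in> T" using assms(1) by blast
    have "X t \<noteq> {}" using semi[OF t] unfolding semimetric_space_def by (rule conjunct1)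
    then show ?thesis using t by blast
  qed
  moreover have "0 \<le> union_dist T X d x y \<and> (union_dist T X d x y = 0 \<longleftrightarrow> x = y) \<and>
      union_dist T X d x y = union_dist T X d y x"
    if xy: "x \<in> (\<Union>t\<in>T. X t)" "y \<in> (\<Union>t\<in>T. X t)" for x y
  proof -
    obtain p where p: "p \<in> T" "x \<in> X p" "y \<in> X p"
      by (rule increasing_family_common_index3[OF assms(2,3) xy xy(2)])
    have "0 \<le> d p x y" "d p x y = 0 \<longleftrightarrow> x = y" "d p x y = d p y x"
      using semi[OF p(1)] p(2,3) unfolding semimetric_space_def by blast+
    then show ?thesis
      unfolding union_dist_eq[OF assms(2,3) p] union_dist_eq[OF assms(2,3) p(1,3,2)] by blast
  qed
  ultimately show ?thesis unfolding semimetric_space_def by blast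
qed

lemma strong_b_metric_space_UNION:
  assumes "K \<ge> 1" "T \<noteq> {}" "linear_order_on T r" "increasing_family T r X d"
    and strong: "\<And>t. t \<in> T \<Longrightarrow> strong_b_metric_space K (X t) (d t)"
  shows "strong_b_metric_space K (\<Union>t\<in>T. X t) (union_dist T X d)"
proof -
  have "semimetric_space (\<Union>t\<in>T. X t) (union_dist T X d)"
    using semimetric_space_UNION[OF assms(2-4)] strong by (simp add: strong_b_metric_space_def)
  moreover have "union_dist T X d x z \<le> K * union_dist T X d x y + union_dist T X d y z"
    if xyz: "x \<in> (\<Union>t\<in>T. X t)" "y \<in> (\<Union>t\<in>T. X t)" "z \<in> (\<Union>t\<in>T. X t)" for x y z
  proof -
    obtain p where p: "p \<in> T" "x \<in> X p" "y \<in> X p" "z \<in> X p"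
      by (rule increasing_family_common_index3[OF assms(3,4) xyz])
    then show ?thesis
      using strong[OF p(1)]
      by (simp add: union_dist_eq[OF assms(3,4) p(1)] strong_b_metric_space_def)
  qed
  ultimately show ?thesis using assms(1) unfolding strong_b_metric_space_def by blast
qed

lemma b_metric_space_UNION:
  assumes "K \<ge> 1" "T \<noteq> {}" "linear_order_on T r" "increasing_family T r X d"
    and b_metric: "\<And>t. t \<in> T \<Longrightarrow> b_metric_space K (X t) (d t)"
  shows "b_metric_space K (\<Union>t\<in>T. X t) (union_dist T X d)"
proof -
  have "semimetric_space (\<Union>t\<in>T. X t) (union_dist T X d)"
    using semimetric_space_UNION[OF assms(2-4)] b_metric by (simp add: b_metric_space_def)
  moreover have "union_dist T X d x z \<le> K * (union_dist T X d x y + union_dist T X d y z)"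
    if xyz: "x \<in> (\<Union>t\<in>T. X t)" "y \<in> (\<Union>t\<in>T. X t)" "z \<in> (\<Union>t\<in>T. X t)" for x y z
  proof -
    obtain p where p: "p \<in> T" "x \<in> X p" "y \<in> X p" "z \<in> X p"
      by (rule increasing_family_common_index3[OF assms(3,4) xyz])
    then show ?thesis
      using b_metric[OF p(1)]
      by (simp add: union_dist_eq[OF assms(3,4) p(1)] b_metric_space_def)
  qed
  ultimately show ?thesis using assms(1) unfolding b_metric_space_def by blast
qed

theorem lemma3p2:
  fixes K :: real
    and T :: "'i set" and r :: "'i rel"
    and X :: "'i \<Rightarrow> 'a set" and d :: "'i \<Rightarrow> 'a \<Rightarrow> 'a \<Rightarrow> real"
  assumes "K \<ge> 1"
    and "T \<noteq> {}"
    and "linear_order_on T r"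
    and "increasing_family T r X d"
  shows
    "((\<forall>t\<in>T. strong_b_metric_space K (X t) (d t)) \<longrightarrow>
        (\<forall>x\<in>(\<Union>t\<in>T. X t). \<forall>y\<in>(\<Union>t\<in>T. X t). \<exists>p\<in>T. x \<in> X p \<and> y \<in> X p) \<and>
        (\<forall>p\<in>T. \<forall>x\<in>X p. \<forall>y\<in>X p. union_dist T X d x y = d p x y) \<and>
        strong_b_metric_space K (\<Union>t\<in>T. X t) (union_dist T X d)) \<and>
     ((\<forall>t\<in>T. b_metric_space K (X t) (d t)) \<longrightarrow>
        (\<forall>x\<in>(\<Union>t\<in>T. X t). \<forall>y\<in>(\<Union>t\<in>T. X t). \<exists>p\<in>T. x \<in> X p \<and> y \<in> X p) \<and>
        (\<forall>p\<in>T. \<forall>x\<in>X p. \<forall>y\<in>X p. union_dist T X d x y = d p x y) \<and>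
        b_metric_space K (\<Union>t\<in>T. X t) (union_dist T X d))"
proof -
  have "\<exists>p\<in>T. x \<in> X p \<and> y \<in> X p"
    if xy: "x \<in> (\<Union>t\<in>T. X t)" "y \<in> (\<Union>t\<in>T. X t)" for x y
    by (rule increasing_family_common_index3[OF assms(3,4) xy xy(2)]) blast
  moreover have "\<forall>p\<in>T. \<forall>x\<in>X p. \<forall>y\<in>X p. union_dist T X d x y = d p x y"
    using union_dist_eq[OF assms(3,4)] by blast
  ultimately show ?thesis
    using strong_b_metric_space_UNION[OF assms] b_metric_space_UNION[OF assms] by simp
qed

end
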